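(* For any $\widehat H_\diamond\in\mathcal F_\diamond$ and any $\delta\ge 0$ the element $H_\diamond(\cdot,\delta)=\phi^\delta(\widehat H_\diamond)$ is well-defined. Moreover, for any $\mathbf k\in\mathbb Z_\diamond^{2n}$ the function $\mathcal H_{\mathbf k}(\delta)=H_{\mathbf k}(\delta)\,e^{\omega_{\mathbf k'}\delta}$ equals $$\mathcal H_{\mathbf k}(\delta)=\widehat H_{\mathbf k}+P_{\mathbf k}(\widehat H_\diamond,\delta),$$ where $P_{\mathbf k}$ is a polynomial in the variables $\widehat H_{\mathbf m}$, $|\mathbf m|<|\mathbf k|$, whose coefficients are finite linear combinations of terms $\delta^s e^{-\nu\delta}$ with $s\in\mathbb Z_+$ and $\nu\ge 0$; moreover, for $\mathbf k'=0$ the equation $\nu=0$ implies $s=0$.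
   Context: Let $n\ge1$ and let $\omega\in\mathbb R^n$ be nonresonant: $\langle q,\omega\rangle\ne0$ for all $q\in\mathbb Z^n\setminus\{0\}$. Let $z=(z_1,\dots,z_n)$, $\overline z=(\overline z_1,\dots,\overline z_n)$ be independent complex variables (the bar is not complex conjugation), $\mathbf z=(z,\overline z)$. $\mathbb Z_+=\{0,1,2,\dots\}$. For $\mathbf k=(k,\overline k)\in\mathbb Z_+^{2n}$ put $\mathbf k'=\overline k-k\in\mathbb Z^n$, let $|\mathbf k|$ be the sum of all components of $\mathbf k$, and $\mathbf z^{\mathbf k}=z^k\overline z^{\overline k}$. Put $\mathbb Z_\diamond^{2n}=\{\mathbf k\in\mathbb Z_+^{2n}:|\mathbf k|\ge3\}$. Let $\mathcal F_\diamond$ be the space of formal power series $H_\diamond=\sum_{\mathbf k\in\mathbb Z_\diamond^{2n}}H_{\mathbf k}\mathbf z^{\mathbf k}$, $H_{\mathbf k}\in\mathbb C$ (no convergence required). Put $H_2=\sum_j\omega_jz_j\overline z_j$, $\{F,G\}=i\sum_{j=1}^n(\partial_{\overline z_j}F\,\partial_{z_j}G-\partial_{z_j}F\,\partial_{\overline z_j}G)$, and for $q\in\mathbb Z^n$: $\sigma_q=\operatorname{sign}\langle\omega,q\rangle$ (with $\sigma_0=0$), $\omega_q=|\langle\omega,q\rangle|$. Define the linear operator $\xi H_\diamond=-i\sum_{|\mathbf k|\ge3}\sigma_{\mathbf k'}H_{\mathbf k}\mathbf z^{\mathbf k}$. Consider the initial value problem $$\partial_\delta H_\diamond=-\{\xi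 H_\diamond,H_2+H_\diamond\},\qquad H_\diamond|_{\delta=0}=\widehat H_\diamond=\sum_{\mathbf k\in\mathbb Z_\diamond^{2n}}\widehat H_{\mathbf k}\mathbf z^{\mathbf k},$$ understood coefficientwise, i.e. as an infinite system of ODEs for the coefficients $H_{\mathbf k}(\delta)$. If on an interval $I\ni0$ a solution $\gamma:I\to\mathcal F_\diamond$ of it exists and is unique, one puts $\phi^\delta(\widehat H_\diamond)=\gamma(\delta)$ for $\delta\in I$ (the normalization flow), and "$\phi^\delta(\widehat H_\diamond)$ is well-defined" means that this holds. *)

theory Defs
  imports "HOL-Analysis.Analysis" "HOL-Library.Poly_Mapping"
begin

text \<open>A multi-index is a pair of exponent vectors: the first component belongs to the
  variables \<open>z\<close>, the second to the (independent) variables \<open>zbar\<close>.\<close>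

type_synonym 'n mindex = "(nat ^ 'n) \<times> (nat ^ 'n)"

definition mdeg :: "'n::finite mindex \<Rightarrow> nat" where
  "mdeg k = (\<Sum>j\<in>UNIV. fst k $ j) + (\<Sum>j\<in>UNIV. snd k $ j)"

definition mdiff :: "'n::finite mindex \<Rightarrow> int ^ 'n" where
  "mdiff k = (\<chi> j. int (snd k $ j) - int (fst k $ j))"

definition Z_diamond :: "'n::finite mindex set" where
  "Z_diamond = {k. 3 \<le> mdeg k}"

definition pairing :: "real ^ 'n \<Rightarrow> int ^ 'n \<Rightarrow> real" where
  "pairing \<omega> q = \<omega> \<bullet> (\<chi> j. real_of_int (q $ j))"

definition nonresonant :: "real ^ 'n::finite \<Rightarrow> bool" where
  "nonresonant \<omega> \<longleftrightarrow> (\<forall>q. q \<noteq> 0 \<longrightarrow> pairing \<omega> q \<noteq> 0)"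

text \<open>A formal power series in \<open>(z, zbar)\<close> is identified with its family of coefficients.\<close>

type_synonym 'n series = "'n mindex \<Rightarrow> complex"

definition F_diamond :: "'n::finite series set" where
  "F_diamond = {H. \<forall>k. k \<notin> Z_diamond \<longrightarrow> H k = 0}"

lemma finite_mindex_splittings:
  fixes k :: "'n::finite mindex"
  shows "finite {(a, b). a + b = k}"
proof -
  have fin: "finite {x :: nat ^ 'n. \<forall>j. x $ j \<le> u $ j}" for u
  proof (rule finite_subset)
    show "{x :: nat ^ 'n. \<forall>j. x $ j \<le> u $ j} \<subseteq> vec_lambda ` (PiE UNIV (\<lambda>j. {..u $ j}))"
    proof
      fix x :: "nat ^ 'n"
      assume "x \<in> {x. \<forall>j. x $ j \<le> u $ j}"
      hence "(\<lambda>j. x $ j) \<in> PiE UNIV (\<lambda>j. {..u $ j})"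
        by (simp add: PiE_def)
      thus "x \<in> vec_lambda ` (PiE UNIV (\<lambda>j. {..u $ j}))"
        by (metis imageI vec_nth_inverse)
    qed
    show "finite (vec_lambda ` (PiE UNIV (\<lambda>j. {..u $ j})) :: (nat ^ 'n) set)"
      by (intro finite_imageI finite_PiE) auto
  qed
  let ?D = "{x. \<forall>j. x $ j \<le> fst k $ j} \<times> {x. \<forall>j. x $ j \<le> snd k $ j}"
  have "finite (?D \<times> ?D)"
    by (intro finite_cartesian_product fin)
  moreover have "{(a, b). a + b = k} \<subseteq> ?D \<times> ?D"
    by auto
  ultimately show ?thesis
    by (rule finite_subset[rotated])
qed

definition series_mult :: "'n::finite series \<Rightarrow> 'n series \<Rightarrow> 'n series" where
  "series_mult F G k = (\<Sum>(a, b) | a + b = k. F a * G b)"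

definition deriv_z :: "'n::finite \<Rightarrow> 'n series \<Rightarrow> 'n series" where
  "deriv_z j F k = of_nat (fst k $ j + 1) * F (fst k + axis j 1, snd k)"

definition deriv_zbar :: "'n::finite \<Rightarrow> 'n series \<Rightarrow> 'n series" where
  "deriv_zbar j F k = of_nat (snd k $ j + 1) * F (fst k, snd k + axis j 1)"

definition poisson :: "'n::finite series \<Rightarrow> 'n series \<Rightarrow> 'n series" where
  "poisson F G k = \<i> * (\<Sum>j\<in>UNIV.
      series_mult (deriv_zbar j F) (deriv_z j G) k - series_mult (deriv_z j F) (deriv_zbar j G) k)"

definition H2 :: "real ^ 'n::finite \<Rightarrow> 'n series" where
  "H2 \<omega> k = (\<Sum>j\<in>UNIV. if k = (axis j 1, axis j 1) then of_real (\<omega> $ j) else 0)"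

text \<open>On \<open>F_diamond\<close> this is the sum over \<open>|k| \<ge> 3\<close>, all other coefficients being zero there.\<close>

definition xi :: "real ^ 'n::finite \<Rightarrow> 'n series \<Rightarrow> 'n series" where
  "xi \<omega> H k = - \<i> * of_real (sgn (pairing \<omega> (mdiff k))) * H k"

definition nf_solution ::
    "real ^ 'n::finite \<Rightarrow> 'n series \<Rightarrow> real set \<Rightarrow> (real \<Rightarrow> 'n series) \<Rightarrow> bool" where
  "nf_solution \<omega> Hhat I \<gamma> \<longleftrightarrow>
     (\<forall>t\<in>I. \<gamma> t \<in> F_diamond) \<and> \<gamma> 0 = Hhat \<and>
     (\<forall>k. \<forall>t\<in>I. ((\<lambda>s. \<gamma> s k) has_vector_derivative
        - poisson (xi \<omega> (\<gamma> t)) (\<lambda>m. H2 \<omega> m + \<gamma> t m) k) (at t within I))"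

text \<open>Only the values on \<open>I\<close> count, hence uniqueness is up to equality on \<open>I\<close>. The degenerate
  interval \<open>{0}\<close>, on which the differential equation is void, is excluded.\<close>

definition nf_unique_solution ::
    "real ^ 'n::finite \<Rightarrow> 'n series \<Rightarrow> real set \<Rightarrow> (real \<Rightarrow> 'n series) \<Rightarrow> bool" where
  "nf_unique_solution \<omega> Hhat I \<gamma> \<longleftrightarrow>
     is_interval I \<and> 0 \<in> I \<and> I \<noteq> {0} \<and> nf_solution \<omega> Hhat I \<gamma> \<and>
     (\<forall>\<gamma>'. nf_solution \<omega> Hhat I \<gamma>' \<longrightarrow> (\<forall>t\<in>I. \<gamma>' t = \<gamma> t))"

definition nf_flow_well_defined :: "real ^ 'n::finite \<Rightarrow> real \<Rightarrow> 'n series \<Rightarrow> bool" where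
  "nf_flow_well_defined \<omega> \<delta> Hhat \<longleftrightarrow> (\<exists>I \<gamma>. \<delta> \<in> I \<and> nf_unique_solution \<omega> Hhat I \<gamma>)"

definition nf_flow :: "real ^ 'n::finite \<Rightarrow> real \<Rightarrow> 'n series \<Rightarrow> 'n series" where
  "nf_flow \<omega> \<delta> Hhat = (THE H. \<exists>I \<gamma>. \<delta> \<in> I \<and> nf_unique_solution \<omega> Hhat I \<gamma> \<and> H = \<gamma> \<delta>)"

text \<open>\<open>c\<close> represents the finite linear combination of the functions
  \<open>\<delta> ^ s * exp (- \<nu> * \<delta>)\<close> in which the term
  with exponents \<open>(s, \<nu>)\<close> has coefficient \<open>lookup c (s, \<nu>)\<close>.\<close>

type_synonym exp_comb = "(nat \<times> real) \<Rightarrow>\<^sub>0 complex"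

definition exp_comb_eval :: "exp_comb \<Rightarrow> real \<Rightarrow> complex" where
  "exp_comb_eval c \<delta> =
     (\<Sum>(s, \<nu>)\<in>Poly_Mapping.keys c.
        Poly_Mapping.lookup c (s, \<nu>) * of_real (\<delta> ^ s * exp (- \<nu> * \<delta>)))"

text \<open>Polynomials over such combinations in variables indexed by \<open>'v\<close>: a monomial is a finitely
  supported family of exponents, a polynomial a finitely supported family of coefficients.\<close>

type_synonym 'v exp_poly = "('v \<Rightarrow>\<^sub>0 nat) \<Rightarrow>\<^sub>0 exp_comb"

definition exp_poly_vars :: "'v exp_poly \<Rightarrow> 'v set" where
  "exp_poly_vars P = (\<Union>\<alpha>\<in>Poly_Mapping.keys P. Poly_Mapping.keys \<alpha>)"

definition exp_poly_exponents :: "'v exp_poly \<Rightarrow> (nat \<times> real) set" where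
  "exp_poly_exponents P = (\<Union>\<alpha>\<in>Poly_Mapping.keys P. Poly_Mapping.keys (Poly_Mapping.lookup P \<alpha>))"

definition exp_poly_eval :: "'v exp_poly \<Rightarrow> ('v \<Rightarrow> complex) \<Rightarrow> real \<Rightarrow> complex" where
  "exp_poly_eval P x \<delta> =
     (\<Sum>\<alpha>\<in>Poly_Mapping.keys P. exp_comb_eval (Poly_Mapping.lookup P \<alpha>) \<delta> *
        (\<Prod>m\<in>Poly_Mapping.keys \<alpha>. x m ^ Poly_Mapping.lookup \<alpha> m))"

end

theory Submission
  imports Defs
begin

text \<open>The bracket with \<open>H2\<close> contributes \<open>- freq \<omega> k * H k\<close> to the equation for \<open>H k\<close>, and the quadratic
  bracket involves only coefficients of lower degree. The system is therefore triangular and can be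
  solved by recursion on the degree: after multiplication by \<open>exp (freq \<omega> k * t)\<close> the derivative of
  the coefficient is a combination of products of lower coefficients, and each step is one
  integration of an exponential polynomial. Secular terms arise only from integrands with
  exponent \<open>\<nu> = 0\<close>, and for \<open>mdiff k = 0\<close> no such integrands occur.\<close>

subsection \<open>Functions given by exponential polynomials\<close>

definition exp_term :: "('v \<Rightarrow>\<^sub>0 nat) \<Rightarrow> nat \<Rightarrow> real \<Rightarrow> ('v \<Rightarrow> complex) \<Rightarrow> real \<Rightarrow> complex" where
  "exp_term \<alpha> s \<nu> x t = of_real (t ^ s * exp (- \<nu> * t)) *
     (\<Prod>m\<in>Poly_Mapping.keys \<alpha>. x m ^ Poly_Mapping.lookup \<alpha> m)"

text \<open>A semantic counterpart of \<open>exp_poly\<close>: closure under products and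
  integration is proved for functions, term by term, while \<open>V\<close> and \<open>E\<close>
  record which variables and which exponents may occur. The passage to a formal polynomial is made
  only once, at the end.\<close>

inductive exp_poly_fun ::
    "'v set \<Rightarrow> (nat \<times> real) set \<Rightarrow> (('v \<Rightarrow> complex) \<Rightarrow> real \<Rightarrow> complex) \<Rightarrow> bool"
  for V E where
  zero: "exp_poly_fun V E (\<lambda>x t. 0)"
| add_term: "exp_poly_fun V E f \<Longrightarrow> Poly_Mapping.keys \<alpha> \<subseteq> V \<Longrightarrow> (s, \<nu>) \<in> E \<Longrightarrow>
    exp_poly_fun V E (\<lambda>x t. f x t + c * exp_term \<alpha> s \<nu> x t)"

section \<open>Evaluation of formal exponential polynomials\<close>

lemma exp_comb_eval_superset:
  assumes "finite S" "Poly_Mapping.keys c \<subseteq> S"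
  shows "exp_comb_eval c t =
    (\<Sum>(s, \<nu>)\<in>S. Poly_Mapping.lookup c (s, \<nu>) * of_real (t ^ s * exp (- \<nu> * t)))"
  unfolding exp_comb_eval_def
  by (rule sum.mono_neutral_left) (use assms in \<open>auto simp: in_keys_iff\<close>)

lemma exp_comb_eval_add: "exp_comb_eval (c + d) t = exp_comb_eval c t + exp_comb_eval d t"
proof -
  let ?S = "Poly_Mapping.keys c \<union> Poly_Mapping.keys d"
  have "Poly_Mapping.keys (c + d) \<subseteq> ?S"
    by (rule Poly_Mapping.keys_add)
  then show ?thesis
    by (simp add: exp_comb_eval_superset[of ?S] lookup_add algebra_simps case_prod_beta sum.distrib)
qed

lemma exp_comb_eval_zero [simp]: "exp_comb_eval 0 t = 0"
  by (simp add: exp_comb_eval_def)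

lemma exp_comb_eval_single:
  "exp_comb_eval (Poly_Mapping.single (s, \<nu>) c) t = c * of_real (t ^ s * exp (- \<nu> * t))"
  by (subst exp_comb_eval_superset[of "{(s, \<nu>)}"]) auto

lemma exp_poly_eval_superset:
  assumes "finite S" "Poly_Mapping.keys P \<subseteq> S"
  shows "exp_poly_eval P x t = (\<Sum>\<alpha>\<in>S. exp_comb_eval (Poly_Mapping.lookup P \<alpha>) t *
        (\<Prod>m\<in>Poly_Mapping.keys \<alpha>. x m ^ Poly_Mapping.lookup \<alpha> m))"
  unfolding exp_poly_eval_def
  by (rule sum.mono_neutral_left) (use assms in \<open>auto simp: in_keys_iff\<close>)

lemma exp_poly_eval_add: "exp_poly_eval (P + Q) x t = exp_poly_eval P x t + exp_poly_eval Q x t"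
proof -
  let ?S = "Poly_Mapping.keys P \<union> Poly_Mapping.keys Q"
  have "Poly_Mapping.keys (P + Q) \<subseteq> ?S"
    by (rule Poly_Mapping.keys_add)
  then show ?thesis
    by (simp add: exp_poly_eval_superset[of ?S] lookup_add exp_comb_eval_add algebra_simps sum.distrib)
qed

lemma exp_poly_eval_single:
  "exp_poly_eval (Poly_Mapping.single \<alpha> (Poly_Mapping.single (s, \<nu>) c)) x t = c * exp_term \<alpha> s \<nu> x t"
  by (subst exp_poly_eval_superset[of "{\<alpha>}"]) (auto simp: exp_comb_eval_single exp_term_def)

text \<open>A nonzero inner coefficient already forces the outer coefficient to be nonzero, so
  exponents can be read off from coefficients alone. For sums, where terms may cancel, this gives
  the inclusion at once.\<close>

lemma mem_exp_poly_exponents: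
  "e \<in> exp_poly_exponents P \<longleftrightarrow> (\<exists>\<alpha>. Poly_Mapping.lookup (Poly_Mapping.lookup P \<alpha>) e \<noteq> 0)"
proof -
  have "Poly_Mapping.lookup P \<alpha> \<noteq> 0" if "Poly_Mapping.lookup (Poly_Mapping.lookup P \<alpha>) e \<noteq> 0" for \<alpha>
    using that by auto
  then show ?thesis
    by (auto simp: exp_poly_exponents_def in_keys_iff)
qed

lemma exp_poly_exponents_add:
  "exp_poly_exponents (P + Q) \<subseteq> exp_poly_exponents P \<union> exp_poly_exponents Q"
  by (auto simp: mem_exp_poly_exponents lookup_add)

lemma exp_poly_vars_add: "exp_poly_vars (P + Q) \<subseteq> exp_poly_vars P \<union> exp_poly_vars Q"
  unfolding exp_poly_vars_def using Poly_Mapping.keys_add[of P Q] by blast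

text \<open>Each added term is a single monomial with a single exponent pair. Cancellation in
  \<open>P + ?Q\<close> can only shrink the sets of variables and exponents, which is why inclusions
  are carried through the induction.\<close>

lemma exp_poly_fun_representable:
  assumes "exp_poly_fun V E f"
  obtains P where "exp_poly_vars P \<subseteq> V" "exp_poly_exponents P \<subseteq> E"
    "\<And>x t. exp_poly_eval P x t = f x t"
proof -
  have "\<exists>P. exp_poly_vars P \<subseteq> V \<and> exp_poly_exponents P \<subseteq> E \<and>
      (\<forall>x t. exp_poly_eval P x t = f x t)"
    using assms
  proof induction
    case zero
    show ?case
      by (rule exI[of _ 0]) (auto simp: exp_poly_vars_def exp_poly_exponents_def exp_poly_eval_def)
  next
    case (add_term f \<alpha> s \<nu> c)
    then obtain P where P: "exp_poly_vars P \<subseteq> V" "exp_poly_exponents P \<subseteq> E"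
      "\<And>x t. exp_poly_eval P x t = f x t"
      by auto
    let ?Q = "Poly_Mapping.single \<alpha> (Poly_Mapping.single (s, \<nu>) c)"
    have "exp_poly_vars ?Q \<subseteq> V" "exp_poly_exponents ?Q \<subseteq> E"
      using add_term.hyps by (auto simp: exp_poly_vars_def exp_poly_exponents_def)
    then have "exp_poly_vars (P + ?Q) \<subseteq> V" "exp_poly_exponents (P + ?Q) \<subseteq> E"
      using P exp_poly_vars_add[of P ?Q] exp_poly_exponents_add[of P ?Q] by auto
    then show ?case
      by (intro exI[of _ "P + ?Q"]) (simp add: exp_poly_eval_add exp_poly_eval_single P)
  qed
  then show ?thesis using that by blast
qed

section \<open>Closure properties of exponential polynomial functions\<close>

lemma exp_poly_fun_term:
  assumes "Poly_Mapping.keys \<alpha> \<subseteq> V" "(s, \<nu>) \<in> E"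
  shows "exp_poly_fun V E (\<lambda>x t. c * exp_term \<alpha> s \<nu> x t)"
  using exp_poly_fun.add_term[OF exp_poly_fun.zero assms] by simp

lemma exp_poly_fun_add:
  assumes "exp_poly_fun V E f" "exp_poly_fun V E g"
  shows "exp_poly_fun V E (\<lambda>x t. f x t + g x t)"
  using assms(2)
proof induction
  case zero
  then show ?case using assms(1) by simp
next
  case (add_term g \<alpha> s \<nu> c)
  from exp_poly_fun.add_term[OF add_term.IH add_term.hyps(2,3), of c]
  show ?case by (simp add: add.assoc)
qed

lemma exp_poly_fun_cmult:
  assumes "exp_poly_fun V E f"
  shows "exp_poly_fun V E (\<lambda>x t. c * f x t)"
  using assms
proof induction
  case zero
  then show ?case by (simp add: exp_poly_fun.zero)
next
  case (add_term f \<alpha> s \<nu> d)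
  from exp_poly_fun.add_term[OF add_term.IH add_term.hyps(2,3), of "c * d"]
  show ?case by (simp add: algebra_simps)
qed

lemma exp_poly_fun_sum:
  assumes "\<And>i. i \<in> A \<Longrightarrow> exp_poly_fun V E (f i)"
  shows "exp_poly_fun V E (\<lambda>x t. \<Sum>i\<in>A. f i x t)"
  using assms
  by (induction A rule: infinite_finite_induct) (auto intro: exp_poly_fun.zero exp_poly_fun_add)

lemma exp_poly_fun_mono:
  assumes "exp_poly_fun V E f" "V \<subseteq> V'" "E \<subseteq> E'"
  shows "exp_poly_fun V' E' f"
  using assms by induction (auto intro!: exp_poly_fun.intros)

lemma exp_term_mult:
  "exp_term \<alpha> s \<nu> x t * exp_term \<beta> r \<mu> x t = exp_term (\<alpha> + \<beta>) (s + r) (\<nu> + \<mu>) x t"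
proof -
  let ?S = "Poly_Mapping.keys \<alpha> \<union> Poly_Mapping.keys \<beta>"
  \<comment> \<open>Variables of exponent 0 contribute the factor 1, so all three products may run
    over the same index set.\<close>
  have ext: "(\<Prod>m\<in>Poly_Mapping.keys \<gamma>. x m ^ Poly_Mapping.lookup \<gamma> m) =
      (\<Prod>m\<in>?S. x m ^ Poly_Mapping.lookup \<gamma> m)" if "Poly_Mapping.keys \<gamma> \<subseteq> ?S" for \<gamma>
    by (rule prod.mono_neutral_left) (use that in \<open>auto simp: in_keys_iff\<close>)
  have "(\<Prod>m\<in>Poly_Mapping.keys (\<alpha> + \<beta>). x m ^ Poly_Mapping.lookup (\<alpha> + \<beta>) m) =
      (\<Prod>m\<in>?S. x m ^ Poly_Mapping.lookup \<alpha> m) * (\<Prod>m\<in>?S. x m ^ Poly_Mapping.lookup \<beta> m)"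
    by (subst ext[OF Poly_Mapping.keys_add]) (simp only: lookup_add power_add prod.distrib)
  moreover have "t ^ (s + r) * exp (- (\<nu> + \<mu>) * t) = (t ^ s * exp (- \<nu> * t)) * (t ^ r * exp (- \<mu> * t))"
    by (simp add: power_add exp_add[symmetric] ring_distribs)
  ultimately show ?thesis
    unfolding exp_term_def by (simp only: ext[OF Un_upper1] ext[OF Un_upper2] of_real_mult mult_ac)
qed

text \<open>The exponent sets of the factors and of the product are kept separate, so that strict
  positivity of \<nu> in one factor can be passed on to the product.\<close>

lemma exp_poly_fun_mult:
  assumes "exp_poly_fun V E f" "exp_poly_fun V E' g"
    and "\<And>s \<nu> r \<mu>. (s, \<nu>) \<in> E \<Longrightarrow> (r, \<mu>) \<in> E' \<Longrightarrow> (s + r, \<nu> + \<mu>) \<in> E''"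
  shows "exp_poly_fun V E'' (\<lambda>x t. f x t * g x t)"
  using assms(1)
proof induction
  case zero
  then show ?case by (simp add: exp_poly_fun.zero)
next
  case (add_term f \<alpha> s \<nu> c)
  have "exp_poly_fun V E'' (\<lambda>x t. c * exp_term \<alpha> s \<nu> x t * g x t)"
    using assms(2)
  proof induction
    case zero
    then show ?case by (simp add: exp_poly_fun.zero)
  next
    case (add_term g \<beta> r \<mu> d)
    have "Poly_Mapping.keys (\<alpha> + \<beta>) \<subseteq> V"
      using Poly_Mapping.keys_add[of \<alpha> \<beta>] add_term.hyps \<open>Poly_Mapping.keys \<alpha> \<subseteq> V\<close> by auto
    from exp_poly_fun.add_term[OF add_term.IH this
        assms(3)[OF \<open>(s, \<nu>) \<in> E\<close> add_term.hyps(3)], of "c * d"]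
    show ?case by (simp add: exp_term_mult[symmetric] ring_distribs mult_ac)
  qed
  from exp_poly_fun_add[OF add_term.IH this] show ?case
    by (simp add: algebra_simps)
qed

lemma exp_poly_fun_var:
  assumes "m \<in> V" "(0, 0) \<in> E"
  shows "exp_poly_fun V E (\<lambda>x t. x m)"
  using exp_poly_fun_term[of "Poly_Mapping.single m 1" V 0 0 E 1] assms by (simp add: exp_term_def)

lemma exp_poly_fun_exp:
  assumes "(0, \<nu>) \<in> E"
  shows "exp_poly_fun V E (\<lambda>x t. of_real (exp (- \<nu> * t)))"
  using exp_poly_fun_term[of 0 V 0 \<nu> E 1] assms by (simp add: exp_term_def)

text \<open>Provides the constant of integration: at time 0 a term with \<open>s > 0\<close>
  vanishes, and one with \<open>s = 0\<close> reduces to its monomial, that is, to exponents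
  \<open>(0, 0)\<close>.\<close>

lemma exp_poly_fun_at_0:
  assumes "exp_poly_fun V E f" "(0, 0) \<in> E"
  shows "exp_poly_fun V E (\<lambda>x t. f x 0)"
  using assms(1)
proof induction
  case zero
  then show ?case by (rule exp_poly_fun.zero)
next
  case (add_term f \<alpha> s \<nu> c)
  have "exp_term \<alpha> s \<nu> x 0 = (if s = 0 then 1 else 0) * exp_term \<alpha> 0 0 x t"
    for x :: "'a \<Rightarrow> complex" and t
    by (simp add: exp_term_def)
  then have "exp_poly_fun V E (\<lambda>x t. c * exp_term \<alpha> s \<nu> x 0)"
    using exp_poly_fun_term[OF add_term.hyps(2) assms(2), of "c * (if s = 0 then 1 else 0)"]
    by (simp add: mult.assoc)
  with add_term.IH show ?case by (rule exp_poly_fun_add)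
qed

section \<open>Antiderivatives\<close>

lemma has_vector_derivative_exp_term:
  "(exp_term \<alpha> s \<nu> x has_vector_derivative
     of_nat s * exp_term \<alpha> (s - 1) \<nu> x t - of_real \<nu> * exp_term \<alpha> s \<nu> x t) (at t)"
proof -
  have "((\<lambda>t. t ^ s * exp (- \<nu> * t)) has_real_derivative
      real s * (t ^ (s - 1) * exp (- \<nu> * t)) - \<nu> * (t ^ s * exp (- \<nu> * t))) (at t)"
    by (auto intro!: derivative_eq_intros simp: algebra_simps)
  from has_vector_derivative_mult_left[OF has_vector_derivative_of_real
      [OF this]]
  show ?thesis
    unfolding exp_term_def by (simp add: left_diff_distrib mult.assoc)
qed

text \<open>Integration by parts lowers the power of \<open>t\<close> if \<open>\<nu> \<noteq> 0\<close>; for \<open>\<nu> = 0\<close> integration raises it,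
  which is the only source of secular terms.\<close>

lemma exp_term_antiderivative:
  assumes "Poly_Mapping.keys \<alpha> \<subseteq> V"
    and "\<nu> = 0 \<Longrightarrow> (Suc s, 0) \<in> E" and "\<And>i. \<nu> \<noteq> 0 \<Longrightarrow> i \<le> s \<Longrightarrow> (i, \<nu>) \<in> E"
  shows "\<exists>g. exp_poly_fun V E g \<and>
    (\<forall>x t. (g x has_vector_derivative exp_term \<alpha> s \<nu> x t) (at t))"
proof (cases "\<nu> = 0")
  case True
  have "exp_poly_fun V E (\<lambda>x t. (1 / of_nat (Suc s)) * exp_term \<alpha> (Suc s) 0 x t)"
    using assms True by (intro exp_poly_fun_term) auto
  moreover have "((\<lambda>t. (1 / of_nat (Suc s)) * exp_term \<alpha> (Suc s) 0 x t)
      has_vector_derivative exp_term \<alpha> s 0 x t) (at t)" for x :: "'a \<Rightarrow> complex" and t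
    using has_vector_derivative_mult_right
      [OF has_vector_derivative_exp_term[of \<alpha> "Suc s" 0 x t], of "1 / of_nat (Suc s)"]
    by (simp del: of_nat_Suc)
  ultimately show ?thesis using True by blast
next
  case False
  then have "\<And>i. i \<le> s \<Longrightarrow> (i, \<nu>) \<in> E" using assms(3) by blast
  then show ?thesis
  proof (induction s)
    case 0
    have "exp_poly_fun V E (\<lambda>x t. - (1 / of_real \<nu>) * exp_term \<alpha> 0 \<nu> x t)"
      using assms 0 by (intro exp_poly_fun_term) auto
    moreover have "((\<lambda>t. - (1 / of_real \<nu>) * exp_term \<alpha> 0 \<nu> x t)
        has_vector_derivative exp_term \<alpha> 0 \<nu> x t) (at t)" for x :: "'a \<Rightarrow> complex" and t
      using has_vector_derivative_mult_right
        [OF has_vector_derivative_exp_term[of \<alpha> 0 \<nu> x t], of "- (1 / of_real \<nu>)"] False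
      by simp
    ultimately show ?case by blast
  next
    case (Suc s)
    then obtain g where g: "exp_poly_fun V E g"
      "\<And>x t. (g x has_vector_derivative exp_term \<alpha> s \<nu> x t) (at t)"
      by (metis le_SucI)
    \<comment> \<open>The derivative formula for the term of power \<open>Suc s\<close> is solved
      for that term; its remaining part, of power \<open>s\<close>, is integrated by
      \<open>g\<close>.\<close>
    let ?G = "\<lambda>x t. (of_nat (Suc s) / of_real \<nu>) * g x t + - (1 / of_real \<nu>) * exp_term \<alpha> (Suc s) \<nu> x t"
    have "exp_poly_fun V E ?G"
      using assms(1) Suc.prems g by (intro exp_poly_fun_add exp_poly_fun_cmult exp_poly_fun_term) auto
    moreover have "(?G x has_vector_derivative exp_term \<alpha> (Suc s) \<nu> x t) (at t)"
      for x :: "'a \<Rightarrow> complex" and t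
    proof -
      have "(?G x has_vector_derivative
          (of_nat (Suc s) / of_real \<nu>) * exp_term \<alpha> s \<nu> x t + - (1 / of_real \<nu>) *
          (of_nat (Suc s) * exp_term \<alpha> (Suc s - 1) \<nu> x t - of_real \<nu> * exp_term \<alpha> (Suc s) \<nu> x t)) (at t)"
        by (intro has_vector_derivative_add has_vector_derivative_mult_right g
            has_vector_derivative_exp_term)
      moreover have "(of_nat (Suc s) / of_real \<nu>) * exp_term \<alpha> s \<nu> x t + - (1 / of_real \<nu>) *
          (of_nat (Suc s) * exp_term \<alpha> (Suc s - 1) \<nu> x t - of_real \<nu> * exp_term \<alpha> (Suc s) \<nu> x t) =
          exp_term \<alpha> (Suc s) \<nu> x t"
        using False by (simp add: field_simps del: of_nat_Suc)
      ultimately show ?thesis by simp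
    qed
    ultimately show ?case by blast
  qed
qed

text \<open>The conditions on \<open>E'\<close> list what integration can produce: the constant of
  integration, one more power of \<open>t\<close> when \<nu> = 0, and all powers up to
  \<open>s\<close> at the same \<nu> otherwise.\<close>

lemma exp_poly_fun_antiderivative:
  assumes "exp_poly_fun V E f" and "(0, 0) \<in> E'"
    and "\<And>s. (s, 0) \<in> E \<Longrightarrow> (Suc s, 0) \<in> E'"
    and "\<And>s \<nu> i. (s, \<nu>) \<in> E \<Longrightarrow> \<nu> \<noteq> 0 \<Longrightarrow> i \<le> s \<Longrightarrow> (i, \<nu>) \<in> E'"
  obtains g where "exp_poly_fun V E' g" "\<And>x. g x 0 = 0"
    "\<And>x t. (g x has_vector_derivative f x t) (at t)"
proof -
  have "\<exists>g. exp_poly_fun V E' g \<and> (\<forall>x t. (g x has_vector_derivative f x t) (at t))"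
    using assms(1)
  proof induction
    case zero
    show ?case by (rule exI[of _ "\<lambda>x t. 0"]) (auto intro: exp_poly_fun.zero)
  next
    case (add_term f \<alpha> s \<nu> c)
    then obtain g where g: "exp_poly_fun V E' g"
      "\<And>x t. (g x has_vector_derivative f x t) (at t)"
      by auto
    obtain h where h: "exp_poly_fun V E' h"
      "\<And>x t. (h x has_vector_derivative exp_term \<alpha> s \<nu> x t) (at t)"
      using exp_term_antiderivative[of \<alpha> V \<nu> s E'] add_term.hyps assms(3,4) by blast
    show ?case
      by (rule exI[of _ "\<lambda>x t. g x t + c * h x t"])
        (auto intro!: exp_poly_fun_add exp_poly_fun_cmult has_vector_derivative_add
          has_vector_derivative_mult_right g h)
  qed
  then obtain g where g: "exp_poly_fun V E' g"
    "\<And>x t. (g x has_vector_derivative f x t) (at t)"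
    by auto
  show ?thesis
  proof
    show "exp_poly_fun V E' (\<lambda>x t. g x t + (- 1) * g x 0)"
      by (intro exp_poly_fun_add exp_poly_fun_cmult exp_poly_fun_at_0 g assms)
    show "((\<lambda>t. g x t + - 1 * g x 0) has_vector_derivative f x t) (at t)" for x t
      using has_vector_derivative_add[OF g(2)[of x t] has_vector_derivative_const[of "- g x 0"]]
      by simp
  qed simp
qed

subsection \<open>The Poisson bracket\<close>

lemma mdeg_add: "mdeg (a + b) = mdeg a + mdeg b"
  by (simp add: mdeg_def sum.distrib)

lemma mdeg_add_axis:
  "mdeg (u + axis j 1, v) = Suc (mdeg (u, v))"
  "mdeg (u, v + axis j 1) = Suc (mdeg (u, v))"
  by (simp_all add: mdeg_def sum.distrib axis_def)

lemma mdiff_add_axis: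
  "mdiff (u, v + axis j 1) + mdiff (u' + axis j 1, v') = mdiff (u + u', v + v')"
  "mdiff (u + axis j 1, v) + mdiff (u', v' + axis j 1) = mdiff (u + u', v + v')"
  by (simp_all add: mdiff_def vec_eq_iff axis_def)

lemma pairing_add: "pairing \<omega> (p + q) = pairing \<omega> p + pairing \<omega> q"
proof -
  have "(\<chi> j. real_of_int ((p + q) $ j)) = (\<chi> j. real_of_int (p $ j)) + (\<chi> j. real_of_int (q $ j))"
    by (simp add: vec_eq_iff)
  then show ?thesis by (simp add: pairing_def inner_add_right)
qed

lemma pairing_zero [simp]: "pairing \<omega> 0 = 0"
  by (simp add: pairing_def inner_vec_def)

text \<open>The subtracted term is written as a sum with a negated coefficient, the shape to which
  the closure rules for sums and scalar multiples apply.\<close>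

lemma poisson_expand:
  "poisson F G k = \<i> * (\<Sum>j\<in>UNIV. \<Sum>(a, b) | a + b = k.
     of_nat ((snd a $ j + 1) * (fst b $ j + 1)) *
       (F (fst a, snd a + axis j 1) * G (fst b + axis j 1, snd b)) +
     - of_nat ((fst a $ j + 1) * (snd b $ j + 1)) *
       (F (fst a + axis j 1, snd a) * G (fst b, snd b + axis j 1)))"
  unfolding poisson_def series_mult_def deriv_z_def deriv_zbar_def sum_subtractf[symmetric]
  by (intro arg_cong2[of _ _ _ _ "(*)"] sum.cong refl) (auto simp: algebra_simps)

text \<open>Each factor loses one degree by differentiation, so only pairs of total degree
  \<open>mdeg k + 2\<close> meet. The hypothesis compares products, so a vanishing factor excuses
  any disagreement in the other one.\<close>

lemma poisson_cong:
  assumes "\<And>m l. mdeg m + mdeg l = mdeg k + 2 \<Longrightarrow> F m * G l = F' m * G' l"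
  shows "poisson F G k = poisson F' G' k"
  unfolding poisson_expand
proof (intro arg_cong2[of _ _ _ _ "(*)"] sum.cong refl, clarify)
  fix j a b assume "k = a + b"
  then show "of_nat ((snd a $ j + 1) * (fst b $ j + 1)) *
       (F (fst a, snd a + axis j 1) * G (fst b + axis j 1, snd b)) +
     - of_nat ((fst a $ j + 1) * (snd b $ j + 1)) *
       (F (fst a + axis j 1, snd a) * G (fst b, snd b + axis j 1)) =
     of_nat ((snd a $ j + 1) * (fst b $ j + 1)) *
       (F' (fst a, snd a + axis j 1) * G' (fst b + axis j 1, snd b)) +
     - of_nat ((fst a $ j + 1) * (snd b $ j + 1)) *
       (F' (fst a + axis j 1, snd a) * G' (fst b, snd b + axis j 1))"
    by (subst (1 2) assms) (simp_all add: mdeg_add mdeg_add_axis del: One_nat_def)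
qed

lemma poisson_add_right: "poisson F (\<lambda>m. G m + G' m) k = poisson F G k + poisson F G' k"
  unfolding poisson_expand distrib_left[symmetric] sum.distrib[symmetric]
  by (intro arg_cong2[of _ _ _ _ "(*)"] sum.cong refl) (auto simp: algebra_simps)

text \<open>The two derivatives in each product shift \<open>mdiff\<close> in opposite directions,
  so the weights of paired indices add up to that of \<open>k\<close>. The factor \<open>c\<close>
  is moved inside because a growing exponential becomes admissible only together with the decay of
  each product.\<close>

lemma exp_poly_fun_poisson:
  assumes "\<And>m l. mdeg m + mdeg l = mdeg k + 2 \<Longrightarrow> mdiff m + mdiff l = mdiff k \<Longrightarrow>
    exp_poly_fun V E (\<lambda>x t. c x t * (F x t m * G x t l))"
  shows "exp_poly_fun V E (\<lambda>x t. c x t * poisson (F x t) (G x t) k)"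
proof -
  \<comment> \<open>Splittings are indexed by \<open>p\<close> with projections; a pair pattern
    would hide the summand from the closure rules behind a case expression.\<close>
  have eq: "c x t * poisson (F x t) (G x t) k = \<i> * (\<Sum>j\<in>UNIV. \<Sum>p | fst p + snd p = k.
     of_nat ((snd (fst p) $ j + 1) * (fst (snd p) $ j + 1)) *
       (c x t * (F x t (fst (fst p), snd (fst p) + axis j 1) * G x t (fst (snd p) + axis j 1, snd (snd p)))) +
     - of_nat ((fst (fst p) $ j + 1) * (snd (snd p) $ j + 1)) *
       (c x t * (F x t (fst (fst p) + axis j 1, snd (fst p)) * G x t (fst (snd p), snd (snd p) + axis j 1))))"
    for x t
    unfolding poisson_expand sum_distrib_left
    by (intro sum.cong refl) (auto simp: algebra_simps)
  show ?thesis
    unfolding eq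
    by (intro exp_poly_fun_cmult exp_poly_fun_sum exp_poly_fun_add assms)
      (auto simp: mdeg_add[of "(_, _)" "(_, _)", simplified] mdeg_add_axis mdiff_add_axis simp del: One_nat_def)
qed

section \<open>The bracket with the quadratic Hamiltonian\<close>

lemma add_axis_eq_axis_iff:
  fixes u :: "nat ^ 'n::finite"
  shows "u + axis j 1 = axis i 1 \<longleftrightarrow> i = j \<and> u = 0"
proof
  assume *: "u + axis j 1 = axis i 1"
  then have "u $ j + 1 = axis i 1 $ j"
    by (metis axis_nth vector_add_component)
  then have "i = j" by (auto simp: axis_def split: if_splits)
  with * show "i = j \<and> u = 0" by simp
qed auto

lemma deriv_z_H2: "deriv_z j (H2 \<omega>) b = (if b = (0, axis j 1) then of_real (\<omega> $ j) else 0)"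
proof -
  have "H2 \<omega> (fst b + axis j 1, snd b) =
      (\<Sum>i\<in>UNIV. if i = j then if b = (0, axis j 1) then of_real (\<omega> $ j) else 0 else 0)"
    unfolding H2_def by (intro sum.cong refl) (auto simp: add_axis_eq_axis_iff prod_eq_iff simp del: One_nat_def)
  then show ?thesis by (simp add: deriv_z_def)
qed

lemma deriv_zbar_H2: "deriv_zbar j (H2 \<omega>) b = (if b = (axis j 1, 0) then of_real (\<omega> $ j) else 0)"
proof -
  have "H2 \<omega> (fst b, snd b + axis j 1) =
      (\<Sum>i\<in>UNIV. if i = j then if b = (axis j 1, 0) then of_real (\<omega> $ j) else 0 else 0)"
    unfolding H2_def by (intro sum.cong refl) (auto simp: add_axis_eq_axis_iff prod_eq_iff simp del: One_nat_def)
  then show ?thesis by (simp add: deriv_zbar_def)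
qed

text \<open>Multiplication by a monomial shifts the coefficients: by cancellation,
  \<open>(a, c)\<close> is the only splitting of \<open>a + c\<close> with second component
  \<open>c\<close>.\<close>

lemma series_mult_single:
  "series_mult F (\<lambda>b. if b = c then w else 0) (a + c) = F a * w"
proof -
  have "series_mult F (\<lambda>b. if b = c then w else 0) (a + c) =
      (\<Sum>(a, b)\<in>{(a, c)}. F a * (if b = c then w else 0))"
    unfolding series_mult_def
  proof (rule sum.mono_neutral_right)
    show "\<forall>p\<in>{(x, y). x + y = a + c} - {(a, c)}.
        (case p of (x, y) \<Rightarrow> F x * (if y = c then w else 0)) = 0"
    proof
      fix p assume "p \<in> {(x, y). x + y = a + c} - {(a, c)}"
      then have "fst p + snd p = a + c" "p \<noteq> (a, c)" by (simp_all add: case_prod_beta)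
      then have "snd p \<noteq> c" by (metis add_right_cancel prod.collapse)
      then show "(case p of (x, y) \<Rightarrow> F x * (if y = c then w else 0)) = 0"
        by (simp add: case_prod_beta)
    qed
  qed (simp_all add: finite_mindex_splittings)
  then show ?thesis by simp
qed

lemma series_mult_single_eq_0:
  assumes "\<And>a. a + c \<noteq> k"
  shows "series_mult F (\<lambda>b. if b = c then w else 0) k = 0"
  unfolding series_mult_def
proof (intro sum.neutral ballI)
  fix p assume "p \<in> {(x, y). x + y = k}"
  then have "fst p + snd p = k" by (simp add: case_prod_beta)
  then have "snd p \<noteq> c" using assms by metis
  then show "(case p of (x, y) \<Rightarrow> F x * (if y = c then w else 0)) = 0"
    by (simp add: case_prod_beta)
qed

lemma axis_split:
  fixes u :: "nat ^ 'n::finite"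
  assumes "u $ j \<noteq> 0"
  obtains v where "u = v + axis j 1"
proof
  show "u = (\<chi> i. u $ i - axis j 1 $ i) + axis j 1"
    using assms by (auto simp: vec_eq_iff axis_def)
qed

text \<open>Up to the factor \<open>\<omega> $ j\<close> this is the Euler operator
  \<open>zbar_j d/dzbar_j\<close>, which multiplies a monomial by its exponent in
  \<open>zbar_j\<close>.\<close>

lemma series_mult_deriv_z_H2:
  "series_mult (deriv_zbar j F) (deriv_z j (H2 \<omega>)) k = of_nat (snd k $ j) * of_real (\<omega> $ j) * F k"
proof (cases "snd k $ j = 0")
  case True
  \<comment> \<open>The monomial of \<open>k\<close> is not divisible by
    \<open>zbar_j\<close>.\<close>
  have "a + (0, axis j 1) \<noteq> k" for a
    using True by (auto simp: axis_def)
  then show ?thesis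
    using True by (simp add: series_mult_single_eq_0 deriv_z_H2[abs_def] del: One_nat_def)
next
  case False
  then obtain v where v: "snd k = v + axis j 1" by (rule axis_split)
  then have k: "k = (fst k, v) + (0, axis j 1)" by (simp add: prod_eq_iff)
  have "v $ j + 1 = snd k $ j" by (simp add: v)
  with series_mult_single[of "deriv_zbar j F" "(0, axis j 1)" "of_real (\<omega> $ j)" "(fst k, v)"]
  show ?thesis
    by (simp add: deriv_z_H2[abs_def] deriv_zbar_def v[symmetric] k[symmetric] mult_ac
        del: One_nat_def add_Pair of_nat_Suc flip: of_nat_Suc)
qed

lemma series_mult_deriv_zbar_H2:
  "series_mult (deriv_z j F) (deriv_zbar j (H2 \<omega>)) k = of_nat (fst k $ j) * of_real (\<omega> $ j) * F k"
proof (cases "fst k $ j = 0")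
  case True
  have "a + (axis j 1, 0) \<noteq> k" for a
    using True by (auto simp: axis_def)
  then show ?thesis
    using True by (simp add: series_mult_single_eq_0 deriv_zbar_H2[abs_def] del: One_nat_def)
next
  case False
  then obtain v where v: "fst k = v + axis j 1" by (rule axis_split)
  then have k: "k = (v, snd k) + (axis j 1, 0)" by (simp add: prod_eq_iff)
  have "v $ j + 1 = fst k $ j" by (simp add: v)
  with series_mult_single[of "deriv_z j F" "(axis j 1, 0)" "of_real (\<omega> $ j)" "(v, snd k)"]
  show ?thesis
    by (simp add: deriv_zbar_H2[abs_def] deriv_z_def v[symmetric] k[symmetric] mult_ac
        del: One_nat_def add_Pair of_nat_Suc flip: of_nat_Suc)
qed

text \<open>The difference of the two Euler operators weights each \<open>\<omega> $ j\<close> by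
  the exponent of \<open>zbar_j\<close> minus that of \<open>z_j\<close>, so the bracket acts
  diagonally on monomials.\<close>

lemma poisson_H2: "poisson F (H2 \<omega>) k = \<i> * of_real (pairing \<omega> (mdiff k)) * F k"
proof -
  have "complex_of_real (pairing \<omega> (mdiff k)) =
      (\<Sum>j\<in>UNIV. (of_nat (snd k $ j) - of_nat (fst k $ j)) * of_real (\<omega> $ j))"
    by (simp add: pairing_def inner_vec_def mdiff_def mult.commute)
  then show ?thesis
    by (simp add: poisson_def series_mult_deriv_z_H2 series_mult_deriv_zbar_H2
        sum_distrib_right left_diff_distrib mult.assoc)
qed

subsection \<open>The triangular system for the coefficients\<close>

definition freq :: "real ^ 'n::finite \<Rightarrow> 'n mindex \<Rightarrow> real" where
  "freq \<omega> k = \<bar>pairing \<omega> (mdiff k)\<bar>"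

definition lower :: "'n::finite mindex \<Rightarrow> 'n mindex set" where
  "lower k = {m \<in> Z_diamond. mdeg m < mdeg k}"

definition truncate :: "'n::finite mindex \<Rightarrow> 'n series \<Rightarrow> 'n series" where
  "truncate k F m = (if m \<in> lower k then F m else 0)"

text \<open>Truncation makes the dependence on \<open>lower k\<close> alone hold for every family of
  coefficients, inside \<open>F_diamond\<close> or not; the recursion on the degree relies on
  this.\<close>

definition quadratic_part :: "real ^ 'n::finite \<Rightarrow> 'n series \<Rightarrow> 'n mindex \<Rightarrow> complex" where
  "quadratic_part \<omega> H k = poisson (xi \<omega> (truncate k H)) (truncate k H) k"

lemma quadratic_part_cong:
  assumes "\<And>m. m \<in> lower k \<Longrightarrow> H m = H' m"
  shows "quadratic_part \<omega> H k = quadratic_part \<omega> H' k"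
proof -
  have "truncate k H = truncate k H'"
    using assms by (auto simp: truncate_def)
  then show ?thesis by (simp add: quadratic_part_def)
qed

text \<open>For degree at most 2 the set \<open>lower k\<close> is empty. Hence a solution that
  vanishes at these indices satisfies their equations.\<close>

lemma quadratic_part_eq_0: "k \<notin> Z_diamond \<Longrightarrow> quadratic_part \<omega> H k = 0"
proof -
  assume "k \<notin> Z_diamond"
  then have "truncate k H = (\<lambda>m. 0)"
    by (intro ext) (auto simp: truncate_def lower_def Z_diamond_def)
  then show ?thesis
    by (simp add: quadratic_part_def poisson_expand)
qed

text \<open>A term of the bracket pairs indices of total degree \<open>mdeg k + 2\<close>, both of degree at least 3,
  so only coefficients of degree below \<open>mdeg k\<close> contribute and truncation loses nothing.\<close>

lemma nf_vector_field:
  assumes "H \<in> F_diamond"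
  shows "poisson (xi \<omega> H) (\<lambda>m. H2 \<omega> m + H m) k = of_real (freq \<omega> k) * H k + quadratic_part \<omega> H k"
proof -
  have "poisson (xi \<omega> H) H k = quadratic_part \<omega> H k"
    unfolding quadratic_part_def
  proof (rule poisson_cong)
    fix m l :: "'a mindex"
    assume deg: "mdeg m + mdeg l = mdeg k + 2"
    have "m \<in> Z_diamond \<or> H m = 0" "l \<in> Z_diamond \<or> H l = 0"
      using assms unfolding F_diamond_def by blast+
    with deg have "H m = truncate k H m \<and> H l = truncate k H l \<or> H m = 0 \<or> H l = 0"
      by (auto simp: truncate_def lower_def Z_diamond_def)
    then show "xi \<omega> H m * H l = xi \<omega> (truncate k H) m * truncate k H l"
      by (auto simp: xi_def truncate_def)
  qed
  \<comment> \<open>The factors \<open>i\<close> of the bracket and \<open>-i\<close> of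
    \<open>xi\<close> cancel, and a number times its sign is its absolute value.\<close>
  moreover have "poisson (xi \<omega> H) (H2 \<omega>) k = of_real (freq \<omega> k) * H k"
  proof -
    have "complex_of_real (pairing \<omega> (mdiff k)) * of_real (sgn (pairing \<omega> (mdiff k))) = of_real (freq \<omega> k)"
      by (simp add: freq_def abs_sgn flip: of_real_mult)
    then show ?thesis
      by (simp add: poisson_H2 xi_def ac_simps)
  qed
  ultimately show ?thesis by (simp add: poisson_add_right)
qed

lemma freq_triangle:
  "mdiff m + mdiff l = mdiff k \<Longrightarrow> freq \<omega> k \<le> freq \<omega> m + freq \<omega> l"
  unfolding freq_def by (metis abs_triangle_ineq pairing_add)

text \<open>The exponent of the term with indices \<open>m\<close>, \<open>l\<close> is non-negative by the triangle inequality. If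
  \<open>mdiff k = 0\<close> it equals \<open>2 * freq \<omega> m\<close>, and the terms with \<open>freq \<omega> m = 0\<close> are absent because
  \<open>xi\<close> annihilates them.\<close>

lemma exp_poly_fun_quadratic_part:
  assumes h: "\<And>m. m \<in> lower k \<Longrightarrow> exp_poly_fun V {(s, \<nu>). 0 \<le> \<nu>} (h m)"
  shows "exp_poly_fun V {(s, \<nu>). 0 \<le> \<nu> \<and> (mdiff k = 0 \<longrightarrow> 0 < \<nu>)}
    (\<lambda>x t. of_real (exp (freq \<omega> k * t)) *
      quadratic_part \<omega> (\<lambda>m. of_real (exp (- freq \<omega> m * t)) * h m x t) k)"
  unfolding quadratic_part_def
proof (rule exp_poly_fun_poisson)
  fix m l :: "'a mindex"
  assume diff: "mdiff m + mdiff l = mdiff k"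
  let ?H = "\<lambda>x t. truncate k (\<lambda>m. of_real (exp (- freq \<omega> m * t)) * h m x t)"
  let ?f = "\<lambda>x t. of_real (exp (freq \<omega> k * t)) * (xi \<omega> (?H x t) m * ?H x t l)"
  show "exp_poly_fun V {(s, \<nu>). 0 \<le> \<nu> \<and> (mdiff k = 0 \<longrightarrow> 0 < \<nu>)} ?f"
  proof (cases "m \<in> lower k \<and> l \<in> lower k \<and> freq \<omega> m \<noteq> 0")
    case True
    define \<mu> where "\<mu> = freq \<omega> m + freq \<omega> l - freq \<omega> k"
    have "\<mu> \<ge> 0"
      using freq_triangle[OF diff, of \<omega>] by (simp add: \<mu>_def)
    moreover have "\<mu> > 0" if "mdiff k = 0"
    proof -
      have "freq \<omega> m > 0" using True by (simp add: freq_def)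
      with that show ?thesis by (simp add: \<mu>_def freq_def)
    qed
    ultimately have "exp_poly_fun V {(s, \<nu>). 0 \<le> \<nu> \<and> (mdiff k = 0 \<longrightarrow> 0 < \<nu>)}
        (\<lambda>x t. (- \<i> * of_real (sgn (pairing \<omega> (mdiff m)))) *
          (of_real (exp (- \<mu> * t)) * (h m x t * h l x t)))"
      using True
      \<comment> \<open>The exponential carries the single exponent pair \<open>(0, \<mu>)\<close>;
        adding the non-negative exponents of the two \<open>h\<close> preserves strict
        positivity.\<close>
      by (intro exp_poly_fun_cmult exp_poly_fun_mult[where E = "{(0, \<mu>)}" and E' = "{(s, \<nu>). 0 \<le> \<nu>}"]
          exp_poly_fun_mult[where E = "{(s, \<nu>). 0 \<le> \<nu>}" and E' = "{(s, \<nu>). 0 \<le> \<nu>}"]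
          exp_poly_fun_exp h) (auto intro: add_pos_nonneg)
    moreover have "?f = (\<lambda>x t. (- \<i> * of_real (sgn (pairing \<omega> (mdiff m)))) *
          (of_real (exp (- \<mu> * t)) * (h m x t * h l x t)))"
    proof (intro ext)
      fix x t
      have "exp (- \<mu> * t) = exp (freq \<omega> k * t) * (exp (- freq \<omega> m * t) * exp (- freq \<omega> l * t))"
        by (simp add: \<mu>_def exp_add[symmetric] algebra_simps)
      then show "?f x t = (- \<i> * of_real (sgn (pairing \<omega> (mdiff m)))) *
          (of_real (exp (- \<mu> * t)) * (h m x t * h l x t))"
        using True by (simp add: truncate_def xi_def)
    qed
    ultimately show ?thesis by simp
  next
    case False
    then have "?f = (\<lambda>x t. 0)"
      by (auto simp: truncate_def xi_def freq_def)
    then show ?thesis by (simp add: exp_poly_fun.zero)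
  qed
qed

section \<open>Recursive construction of the coefficients\<close>

definition nf_series ::
    "real ^ 'n::finite \<Rightarrow> ('n mindex \<Rightarrow> 'n series \<Rightarrow> real \<Rightarrow> complex) \<Rightarrow> 'n series \<Rightarrow> real \<Rightarrow> 'n series"
  where "nf_series \<omega> g x t k =
    of_real (exp (- freq \<omega> k * t)) * (if k \<in> Z_diamond then x k + g k x t else 0)"

text \<open>One step of the recursion: \<open>g\<close> is the candidate for index \<open>k\<close>,
  and \<open>f\<close> is the family that supplies the coefficients of lower degree. The exponent
  set encodes the claim on secular terms.\<close>

definition nf_increment ::
    "real ^ 'n::finite \<Rightarrow> ('n mindex \<Rightarrow> 'n series \<Rightarrow> real \<Rightarrow> complex) \<Rightarrow> 'n mindex \<Rightarrow>
      ('n series \<Rightarrow> real \<Rightarrow> complex) \<Rightarrow> bool"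
  where "nf_increment \<omega> f k g \<longleftrightarrow>
    exp_poly_fun (lower k) {(s, \<nu>). 0 \<le> \<nu> \<and> (mdiff k = 0 \<longrightarrow> \<nu> = 0 \<longrightarrow> s = 0)} g \<and>
    (\<forall>x. g x 0 = 0) \<and>
    (\<forall>x t. (g x has_vector_derivative
      - 1 * (of_real (exp (freq \<omega> k * t)) * quadratic_part \<omega> (nf_series \<omega> f x t) k)) (at t))"

lemma nf_increments_exist: "\<exists>g. \<forall>k. nf_increment \<omega> g k (g k)"
proof (rule dependent_wf_choice[OF wf_measure[of mdeg]])
  fix f f' :: "'a mindex \<Rightarrow> 'a series \<Rightarrow> real \<Rightarrow> complex" and k g
  assume "\<And>m. (m, k) \<in> Wellfounded.measure mdeg \<Longrightarrow> f m = f' m"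
  then have "quadratic_part \<omega> (nf_series \<omega> f x t) k = quadratic_part \<omega> (nf_series \<omega> f' x t) k" for x t
    by (intro quadratic_part_cong) (simp add: lower_def nf_series_def)
  then show "nf_increment \<omega> f k g = nf_increment \<omega> f' k g"
    by (simp only: nf_increment_def)
next
  fix k and f :: "'a mindex \<Rightarrow> 'a series \<Rightarrow> real \<Rightarrow> complex"
  assume IH: "\<And>m. (m, k) \<in> Wellfounded.measure mdeg \<Longrightarrow> nf_increment \<omega> f m (f m)"
  let ?E = "{(s, \<nu>). 0 \<le> \<nu> \<and> (mdiff k = 0 \<longrightarrow> \<nu> = 0 \<longrightarrow> s = 0)}"
  let ?h = "\<lambda>m x t. if m \<in> Z_diamond then x m + f m x t else 0"
  let ?q = "\<lambda>x t. of_real (exp (freq \<omega> k * t)) * quadratic_part \<omega> (nf_series \<omega> f x t) k"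
  have "exp_poly_fun (lower k) {(s, \<nu>). 0 \<le> \<nu>} (?h m)" if m: "m \<in> lower k" for m
  proof -
    have Z: "m \<in> Z_diamond" and deg: "mdeg m < mdeg k"
      using m by (simp_all add: lower_def)
    then have "nf_increment \<omega> f m (f m)" by (intro IH) simp
    \<comment> \<open>Only non-negativity of \<nu> is passed on; secular terms in lower coefficients
      do no harm.\<close>
    then have "exp_poly_fun (lower k) {(s, \<nu>). 0 \<le> \<nu>} (f m)"
      unfolding nf_increment_def using deg
      by (elim conjE exp_poly_fun_mono) (auto simp: lower_def)
    with m Z show ?thesis
      by (simp add: exp_poly_fun_add exp_poly_fun_var)
  qed
  from exp_poly_fun_quadratic_part[of k _ ?h, OF this]
  have "exp_poly_fun (lower k) {(s, \<nu>). 0 \<le> \<nu> \<and> (mdiff k = 0 \<longrightarrow> 0 < \<nu>)} (\<lambda>x t. - 1 * ?q x t)"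
    unfolding nf_series_def[abs_def] by (rule exp_poly_fun_cmult)
  then obtain g where "exp_poly_fun (lower k) ?E g" "\<And>x. g x 0 = 0"
      "\<And>x t. (g x has_vector_derivative - 1 * ?q x t) (at t)"
    \<comment> \<open>If \<open>mdiff k = 0\<close>, every integrand has \<nu> > 0, so \<nu> = 0
      arises only from the constant of integration, where \<open>s = 0\<close>.\<close>
    by (rule exp_poly_fun_antiderivative[where E' = ?E]) (auto split: if_splits)
  then have "nf_increment \<omega> f k g" unfolding nf_increment_def by blast
  then show "\<exists>g. nf_increment \<omega> f k g" by blast
qed

section \<open>Uniqueness, existence and the flow\<close>

lemma nf_solution_iff:
  "nf_solution \<omega> Hhat I \<gamma> \<longleftrightarrow> (\<forall>t\<in>I. \<gamma> t \<in> F_diamond) \<and> \<gamma> 0 = Hhat \<and>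
     (\<forall>k. \<forall>t\<in>I. ((\<lambda>s. \<gamma> s k) has_vector_derivative
        - (of_real (freq \<omega> k) * \<gamma> t k + quadratic_part \<omega> (\<gamma> t) k)) (at t within I))"
  unfolding nf_solution_def by (auto simp: nf_vector_field)

text \<open>The integrating factor: \<open>c = freq \<omega> k\<close> removes the linear term in
  the uniqueness proof, and the opposite sign restores it in the existence proof.\<close>

lemma has_vector_derivative_exp_mult:
  fixes f :: "real \<Rightarrow> complex"
  assumes "(f has_vector_derivative f') (at t within I)"
  shows "((\<lambda>t. of_real (exp (c * t)) * f t) has_vector_derivative
    of_real (exp (c * t)) * (f' + of_real c * f t)) (at t within I)"
proof -
  have "((\<lambda>t. exp (c * t)) has_real_derivative c * exp (c * t)) (at t within I)"
    by (auto intro!: derivative_eq_intros)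
  from has_vector_derivative_mult[OF has_vector_derivative_of_real
      [OF this] assms]
  show ?thesis by (simp add: algebra_simps)
qed

text \<open>By induction on the degree the quadratic parts of both solutions agree. Their difference
  then solves a homogeneous linear equation with initial value 0, so its product with the
  integrating factor is constant on the interval.\<close>

lemma nf_solution_unique:
  assumes "nf_solution \<omega> Hhat I \<gamma>" "nf_solution \<omega> Hhat I \<gamma>'"
    and "is_interval I" "0 \<in> I" "t \<in> I"
  shows "\<gamma> t k = \<gamma>' t k"
  using \<open>t \<in> I\<close>
proof (induction "mdeg k" arbitrary: k t rule: less_induct)
  case less
  let ?d = "\<lambda>t. of_real (exp (freq \<omega> k * t)) * (\<gamma> t k - \<gamma>' t k)"
  have "(?d has_vector_derivative 0) (at s within I)" if s: "s \<in> I" for s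
  proof -
    have "quadratic_part \<omega> (\<gamma> s) k = quadratic_part \<omega> (\<gamma>' s) k"
      by (rule quadratic_part_cong) (use less.hyps s in \<open>auto simp: lower_def\<close>)
    moreover have "((\<lambda>s. \<gamma> s k - \<gamma>' s k) has_vector_derivative
        - (of_real (freq \<omega> k) * \<gamma> s k + quadratic_part \<omega> (\<gamma> s) k) -
        - (of_real (freq \<omega> k) * \<gamma>' s k + quadratic_part \<omega> (\<gamma>' s) k)) (at s within I)"
      using assms(1,2) s unfolding nf_solution_iff by (intro has_vector_derivative_diff) blast+
    ultimately have "((\<lambda>s. \<gamma> s k - \<gamma>' s k) has_vector_derivative
        - of_real (freq \<omega> k) * (\<gamma> s k - \<gamma>' s k)) (at s within I)"
      by (simp add: right_diff_distrib)
    from has_vector_derivative_exp_mult[OF this, of "freq \<omega> k"] show ?thesis by simp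
  qed
  then have "?d t = ?d 0"
  proof (rule has_vector_derivative_zero_constant[OF is_interval_convex[OF assms(3)]])
    fix c assume "\<And>s. s \<in> I \<Longrightarrow> ?d s = c"
    from this[OF less.prems] this[OF assms(4)] show "?d t = ?d 0" by (rule trans[OF _ sym])
  qed
  also have "\<dots> = 0" using assms(1,2) by (simp add: nf_solution_def)
  finally show ?case by simp
qed

lemma nf_solution_subset:
  "nf_solution \<omega> Hhat J \<gamma> \<Longrightarrow> I \<subseteq> J \<Longrightarrow> nf_solution \<omega> Hhat I \<gamma>"
  unfolding nf_solution_def
  by (intro conjI allI ballI) (blast intro: has_vector_derivative_within_subset)+

text \<open>The flow is a definite description ranging over all intervals. A global solution
  restricts to each of them, and uniqueness there forces the same value at
  \<open>\<delta>\<close>.\<close>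

lemma nf_flow_eq_global_solution:
  assumes sol: "nf_solution \<omega> Hhat UNIV \<gamma>"
  shows "nf_flow_well_defined \<omega> \<delta> Hhat" "nf_flow \<omega> \<delta> Hhat = \<gamma> \<delta>"
proof -
  have "(UNIV :: real set) \<noteq> {0}"
    by (rule UNIV_not_singleton)
  then have u: "nf_unique_solution \<omega> Hhat UNIV \<gamma>"
    unfolding nf_unique_solution_def
  proof (intro conjI allI impI ballI ext)
    show "\<gamma>' t k = \<gamma> t k" if "nf_solution \<omega> Hhat UNIV \<gamma>'" for \<gamma>' t k
      using nf_solution_unique[OF that sol] by simp
  qed (use sol in simp_all)
  then show "nf_flow_well_defined \<omega> \<delta> Hhat"
    unfolding nf_flow_well_defined_def by blast
  show "nf_flow \<omega> \<delta> Hhat = \<gamma> \<delta>"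
    unfolding nf_flow_def
  proof (rule the_equality)
    show "\<exists>I \<gamma>'. \<delta> \<in> I \<and> nf_unique_solution \<omega> Hhat I \<gamma>' \<and> \<gamma> \<delta> = \<gamma>' \<delta>"
      using u by blast
  next
    fix H
    assume "\<exists>I \<gamma>'. \<delta> \<in> I \<and> nf_unique_solution \<omega> Hhat I \<gamma>' \<and> H = \<gamma>' \<delta>"
    then obtain I \<gamma>' where I: "\<delta> \<in> I" "nf_unique_solution \<omega> Hhat I \<gamma>'" "H = \<gamma>' \<delta>"
      by blast
    have "nf_solution \<omega> Hhat I \<gamma>"
      by (rule nf_solution_subset[OF sol subset_UNIV])
    then have "\<gamma> \<delta> = \<gamma>' \<delta>"
      using I(1,2) unfolding nf_unique_solution_def by blast
    with I(3) show "H = \<gamma> \<delta>" by simp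
  qed
qed

lemma nf_solution_nf_series:
  assumes g: "\<And>k. nf_increment \<omega> g k (g k)" and x: "x \<in> F_diamond"
  shows "nf_solution \<omega> x UNIV (nf_series \<omega> g x)"
  unfolding nf_solution_iff
proof (intro conjI allI ballI)
  show "nf_series \<omega> g x t \<in> F_diamond" for t
    by (simp add: F_diamond_def nf_series_def)
  have "g k x 0 = 0" for k
    using g unfolding nf_increment_def by blast
  moreover have "x k = 0" if "k \<notin> Z_diamond" for k
    using x that unfolding F_diamond_def by blast
  ultimately show "nf_series \<omega> g x 0 = x"
    by (intro ext) (simp add: nf_series_def)
  fix k t
  show "((\<lambda>t. nf_series \<omega> g x t k) has_vector_derivative
      - (of_real (freq \<omega> k) * nf_series \<omega> g x t k + quadratic_part \<omega> (nf_series \<omega> g x t) k)) (at t)"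
  proof (cases "k \<in> Z_diamond")
    case True
    let ?Q = "quadratic_part \<omega> (nf_series \<omega> g x t) k"
    have "(g k x has_vector_derivative - 1 * (of_real (exp (freq \<omega> k * t)) * ?Q)) (at t)"
      using g unfolding nf_increment_def by blast
    then have "((\<lambda>t. x k + g k x t) has_vector_derivative
        0 + - 1 * (of_real (exp (freq \<omega> k * t)) * ?Q)) (at t)"
      by (intro has_vector_derivative_add has_vector_derivative_const)
    from has_vector_derivative_exp_mult[OF this, of "- freq \<omega> k"]
    have "((\<lambda>t. nf_series \<omega> g x t k) has_vector_derivative
        of_real (exp (- freq \<omega> k * t)) * (0 + - 1 * (of_real (exp (freq \<omega> k * t)) * ?Q) +
          of_real (- freq \<omega> k) * (x k + g k x t))) (at t)"
      using True by (simp add: nf_series_def)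
    \<comment> \<open>The two exponentials enter only as mutually inverse numbers \<open>a\<close>
      and \<open>b\<close>.\<close>
    moreover have "a * (0 + - 1 * (b * ?Q) + of_real (- w) * y) = - (of_real w * (a * y) + ?Q)"
      if "a * b = 1" for a b y :: complex and w :: real
    proof -
      have "a * (0 + - 1 * (b * ?Q) + of_real (- w) * y) = - (of_real w * (a * y) + (a * b) * ?Q)"
        by (simp add: ring_distribs)
      with that show ?thesis by simp
    qed
    moreover have "complex_of_real (exp (- freq \<omega> k * t)) * of_real (exp (freq \<omega> k * t)) = 1"
      by (simp add: exp_minus)
    ultimately have "((\<lambda>t. nf_series \<omega> g x t k) has_vector_derivative
        - (of_real (freq \<omega> k) * (of_real (exp (- freq \<omega> k * t)) * (x k + g k x t)) + ?Q)) (at t)"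
      by metis
    \<comment> \<open>Only the coefficient at \<open>k\<close> is unfolded; the series inside the
      quadratic part stays folded.\<close>
    then show ?thesis using True by (simp add: nf_series_def[of \<omega> g x t k])
  next
    case False
    then show ?thesis by (simp add: nf_series_def quadratic_part_eq_0)
  qed
qed

theorem theorem1:
  fixes \<omega> :: "real ^ 'n::finite"
  assumes "nonresonant \<omega>"
  shows "(\<forall>Hhat\<in>F_diamond. \<forall>\<delta>\<ge>0. nf_flow_well_defined \<omega> \<delta> Hhat) \<and>
    (\<forall>k\<in>Z_diamond. \<exists>P :: 'n mindex exp_poly.
        exp_poly_vars P \<subseteq> {m \<in> Z_diamond. mdeg m < mdeg k} \<and>
        (\<forall>(s, \<nu>)\<in>exp_poly_exponents P. \<nu> \<ge> 0 \<and> (mdiff k = 0 \<longrightarrow> \<nu> = 0 \<longrightarrow> s = 0)) \<and>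
        (\<forall>Hhat\<in>F_diamond. \<forall>\<delta>\<ge>0.
           nf_flow \<omega> \<delta> Hhat k * of_real (exp (\<bar>pairing \<omega> (mdiff k)\<bar> * \<delta>)) =
             Hhat k + exp_poly_eval P Hhat \<delta>))"
proof -
  \<comment> \<open>One family \<open>g\<close> serves all initial data and all times, so the
    polynomial obtained from \<open>g k\<close> depends on \<open>k\<close> and
    \<open>\<omega>\<close> only.\<close>
  obtain g where g: "nf_increment \<omega> g k (g k)" for k
    using nf_increments_exist[of \<omega>] by blast
  have sol: "nf_solution \<omega> x UNIV (nf_series \<omega> g x)" if x: "x \<in> F_diamond" for x
    by (rule nf_solution_nf_series[OF g x])
  show ?thesis
  proof (intro conjI ballI allI impI)
    fix x \<delta> assume "x \<in> (F_diamond :: 'n series set)"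
    then show "nf_flow_well_defined \<omega> \<delta> x"
      by (rule nf_flow_eq_global_solution[OF sol])
  next
    fix k :: "'n mindex" assume k: "k \<in> Z_diamond"
    obtain P where P: "exp_poly_vars P \<subseteq> lower k"
      "exp_poly_exponents P \<subseteq> {(s, \<nu>). 0 \<le> \<nu> \<and> (mdiff k = 0 \<longrightarrow> \<nu> = 0 \<longrightarrow> s = 0)}"
      "\<And>x t. exp_poly_eval P x t = g k x t"
      using g[of k] exp_poly_fun_representable[of "lower k" _ "g k"] unfolding nf_increment_def by blast
    have "nf_flow \<omega> \<delta> x k * of_real (exp (\<bar>pairing \<omega> (mdiff k)\<bar> * \<delta>)) = x k + exp_poly_eval P x \<delta>"
      if "x \<in> F_diamond" for x \<delta>
    proof -
      have "nf_flow \<omega> \<delta> x k = of_real (exp (- freq \<omega> k * \<delta>)) * (x k + g k x \<delta>)"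
        using nf_flow_eq_global_solution(2)[OF sol[OF that]] k by (simp add: nf_series_def)
      moreover have "complex_of_real (exp (- freq \<omega> k * \<delta>)) * of_real (exp (freq \<omega> k * \<delta>)) = 1"
        by (simp add: exp_minus flip: of_real_mult)
      ultimately show ?thesis
        by (simp add: P(3) freq_def[symmetric] mult_ac)
    qed
    with P(1,2) show "\<exists>P :: 'n mindex exp_poly.
        exp_poly_vars P \<subseteq> {m \<in> Z_diamond. mdeg m < mdeg k} \<and>
        (\<forall>(s, \<nu>)\<in>exp_poly_exponents P. \<nu> \<ge> 0 \<and> (mdiff k = 0 \<longrightarrow> \<nu> = 0 \<longrightarrow> s = 0)) \<and>
        (\<forall>Hhat\<in>F_diamond. \<forall>\<delta>\<ge>0.
           nf_flow \<omega> \<delta> Hhat k * of_real (exp (\<bar>pairing \<omega> (mdiff k)\<bar> * \<delta>)) =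
             Hhat k + exp_poly_eval P Hhat \<delta>)"
      unfolding lower_def by (intro exI[of _ P]) auto
  qed
qed

end
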